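(* Let $\mathcal T$ be a quasi-uniform triangulation of $\overline\Omega$, and let $U^0,U^1,\dots,U^N\in V_h$ be defined by $U^0=\mathcal R_hu^0$, $$2k^{-1}(\bar\partial_tU^{1/2},v_h)+a_h(U^{1/2},v_h)=(f^{1/2}+2k^{-1}v^0,v_h)\quad\text{for all }v_h\in V_h,$$ and, for $n=1,\dots,N-1$, $$(\bar\partial_t^2U^n,v_h)+a_h(U^n,v_h)=(f^n,v_h)\quad\text{for all }v_h\in V_h .$$ If the CFL condition $k\le\beta^{-1/2}C_{\rm inv}^{-1}h^2$ holds, then the scheme is stable. Moreover, there is a constant $C>0$, depending on $\alpha,\beta,T$ but independent of $h$ and $k$, such that for $1\le m\le N-1$ $$\|\bar\partial_tU^{m+1/2}\|+\|U^{m+1/2}\|_h\le C\big(\|\bar\partial_tU^{1/2}\|+\|U^{1/2}\|_h+\|f\|_{L^\infty(0,T;L^2(\Omega))}\big).$$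
   Context: Data: $\Omega\subset\mathbb R^2$ is a bounded polygonal Lipschitz domain, $T>0$; $f\in L^2(0,T;L^2(\Omega))$ is the given source and $u^0\in H^2_0(\Omega)$, $v^0\in L^2(\Omega)$ are the initial data of the biharmonic wave equation $u_{tt}+\Delta^2u=f$ in $\Omega\times(0,T]$, $u(0)=u^0$, $u_t(0)=v^0$, with clamped boundary conditions $u=\partial u/\partial n=0$ on $\partial\Omega$. $(\cdot,\cdot)$ and $\|\cdot\|$ are the $L^2(\Omega)$ inner product and norm; $a(w,v)=\int_\Omega D^2w:D^2v\,dx$ on $H^2_0(\Omega)$. Time grid: $N$ is a positive integer, $k=T/N$, $t_n=nk$. For a function of time $\phi$ (or a sequence $\phi^n$): $\phi^n=\phi(t_n)$, $\phi^{n+1/2}=\frac12(\phi^{n+1}+\phi^n)$, $\bar\partial_t\phi^{n+1/2}=(\phi^{n+1}-\phi^n)/k$, $\bar\partial_t^2\phi^n=(\phi^{n+1}-2\phi^n+\phi^{n-1})/k^2$. Mesh: $\mathcal T$ is a shape-regular triangulation of $\overline\Omega$ with mesh-size $h=\max_{K\in\mathcal T}\mathrm{diam}(K)$, edges $\mathcal E$, vertices $\mathcal V$; $\mathcal V(e)$ is the set of endpoints of edge $e$ and $h_e$ its length; $[\![\cdot]\!]$ is the jump across an interior edge and the trace on a boundary edge; $\{\!\{\cdot\}\!\}$ is the average across an interior edge and the trace on a boundary edge; $H^2(\mathcal T)$ is the space of piecewise $H^2$ functions; $P_r(\mathcal T)$ is the space of piecewise polynomials of degree at most $r$. Discrete space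 and form: $\mathrm M(\mathcal T)\subset P_2(\mathcal T)$ is the Morley space: piecewise quadratics continuous at interior vertices, with normal derivatives continuous at midpoints of interior edges, vanishing at boundary vertices and with normal derivatives vanishing at midpoints of boundary edges. $V_h\subset H^2(\mathcal T)$ is a finite-dimensional subspace with the norm $$\|v_h\|_h^2=\sum_{K\in\mathcal T}|v_h|_{H^2(K)}^2+\sum_{e\in\mathcal E}\sum_{z\in\mathcal V(e)}h_e^{-2}\big|[\![v_h]\!](z)\big|^2+\sum_{e\in\mathcal E}\Big|\frac1{h_e}\int_e\Big[\!\Big[\frac{\partial v_h}{\partial n}\Big]\!\Big]ds\Big|^2 ,$$ and $a_h$ is a symmetric bilinear form on $V_h+\mathrm M(\mathcal T)$ for which there are constants $\alpha,\beta>0$ such that, for all $w_h,v_h\in V_h$, $\alpha\|w_h\|_h^2\le a_h(w_h,w_h)$ and $a_h(w_h,v_h)\le\beta\|w_h\|_h\|v_h\|_h$. (The Morley, quadratic discontinuous Galerkin and quadratic $C^0$ interior penalty methods, the last two with sufficiently large penalty parameters, are instances.) $C_{\rm inv}>0$ is the constant of the discrete inverse inequality on quasi-uniform meshes: $\|v_h\|_h\le C_{\rm inv}h^{-2}\|v_h\|$ for all $v_h\in V_h$. Smoother: $I_{\mathrm M}:H^2(\mathcal T)\to\mathrm M(\mathcal T)$ is the extended Morley interpolation: at each interior vertex $z$, $(I_{\mathrm M}v)(z)$ is the average of the values $(v|_K)(z)$ over the triangles $K$ containing $z$, and on each interior edge $\int_e\partial_n(I_{\mathrm M}v)\,ds=\int_e\{\!\{\partial_nv\}\!\}\,ds$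 (boundary degrees of freedom vanish). $J:\mathrm M(\mathcal T)\to H^2_0(\Omega)$ is a fixed linear companion operator, with values in the sum of the Hsieh–Clough–Tocher space and $P_8(\mathcal T)$, such that for $w\in\mathrm M(\mathcal T)$: $Jw=w$ at all vertices, $\nabla(Jw)(z)$ is the average of $(\nabla w|_K)(z)$ over the triangles $K$ containing $z$ at every interior vertex $z$, and $\int_e\partial_n(Jw)\,ds=\int_e\partial_nw\,ds$ for every edge $e$. Put $Q:=J I_{\mathrm M}:V_h\to H^2_0(\Omega)$. Modified Ritz projection $\mathcal R_h:H^2_0(\Omega)\to V_h$: $a_h(\mathcal R_hw,v_h)=a(w,Qv_h)$ for all $v_h\in V_h$.
   Formalization: The source f is additionally assumed continuous as an L²(Ω)-valued function at the grid times t_n, since point values f^n are undefined for f merely in L²(0,T;L²(Ω)); "stable" is read as Lipschitz dependence of discrete solutions on starting values and sources. *)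

theory Defs
  imports "HOL-Analysis.Analysis" "HOL-Probability.Essential_Supremum"
begin

section \<open>Lebesgue and Sobolev spaces on planar sets\<close>

text \<open>Elements of Lebesgue and Sobolev spaces are represented by functions on the whole plane;
  only their values (up to null sets) on the set \<open>S\<close> matter.\<close>

type_synonym fn = "real^2 \<Rightarrow> real"

definition L2 :: "(real^2) set \<Rightarrow> fn set" where
  "L2 S = {g. g \<in> borel_measurable (lebesgue_on S) \<and> integrable (lebesgue_on S) (\<lambda>x. (g x)\<^sup>2)}"

definition l2_inner :: "(real^2) set \<Rightarrow> fn \<Rightarrow> fn \<Rightarrow> real" where
  "l2_inner S g w = (LINT x|lebesgue_on S. g x * w x)"

definition l2_norm :: "(real^2) set \<Rightarrow> fn \<Rightarrow> real" where
  "l2_norm S g = sqrt (l2_inner S g g)"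

definition pd :: "2 \<Rightarrow> fn \<Rightarrow> fn" where
  "pd i g x = frechet_derivative g (at x) (axis i 1)"

definition grad :: "fn \<Rightarrow> real^2 \<Rightarrow> real^2" where
  "grad g x = (\<chi> i. pd i g x)"

definition smooth :: "fn \<Rightarrow> bool" where
  "smooth g \<longleftrightarrow> (\<forall>is. foldr pd is g differentiable_on UNIV)"

definition test_function :: "(real^2) set \<Rightarrow> fn \<Rightarrow> bool" where
  "test_function S g \<longleftrightarrow> smooth g \<and> compact (closure {x. g x \<noteq> 0}) \<and> closure {x. g x \<noteq> 0} \<subseteq> S"

definition weak_deriv :: "(real^2) set \<Rightarrow> 2 list \<Rightarrow> fn \<Rightarrow> fn \<Rightarrow> bool" where
  "weak_deriv S is w g \<longleftrightarrow>
     (\<forall>\<phi>. test_function S \<phi> \<longrightarrow>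
        l2_inner S w (foldr pd is \<phi>) = (-1) ^ length is * l2_inner S g \<phi>)"

definition H2 :: "(real^2) set \<Rightarrow> fn set" where
  "H2 S = {w \<in> L2 S. \<forall>is. length is \<le> 2 \<longrightarrow> (\<exists>g\<in>L2 S. weak_deriv S is w g)}"

definition wD :: "(real^2) set \<Rightarrow> 2 list \<Rightarrow> fn \<Rightarrow> fn" where
  "wD S is w = (SOME g. g \<in> L2 S \<and> weak_deriv S is w g)"

definition h2_norm :: "(real^2) set \<Rightarrow> fn \<Rightarrow> real" where
  "h2_norm S w = sqrt (\<Sum>is | length is \<le> 2. (l2_norm S (wD S is w))\<^sup>2)"

definition h2_seminorm :: "(real^2) set \<Rightarrow> fn \<Rightarrow> real" where
  "h2_seminorm S w = sqrt (\<Sum>i\<in>UNIV. \<Sum>j\<in>UNIV. (l2_norm S (wD S [i, j] w))\<^sup>2)"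

definition H20 :: "(real^2) set \<Rightarrow> fn set" where
  "H20 S = {w \<in> H2 S. \<exists>\<phi>. (\<forall>j::nat. test_function S (\<phi> j)) \<and>
     (\<lambda>j. h2_norm S (\<lambda>x. \<phi> j x - w x)) \<longlonglongrightarrow> 0}"

definition plate_form :: "(real^2) set \<Rightarrow> fn \<Rightarrow> fn \<Rightarrow> real" where
  "plate_form S w v = (\<Sum>i\<in>UNIV. \<Sum>j\<in>UNIV. l2_inner S (wD S [i, j] w) (wD S [i, j] v))"


section \<open>Polygonal Lipschitz domains and triangulations\<close>

definition lipschitz_domain :: "(real^2) set \<Rightarrow> bool" where
  "lipschitz_domain S \<longleftrightarrow> open S \<and> connected S \<and> S \<noteq> {} \<and>
     (\<forall>x\<in>frontier S. \<exists>\<nu> \<tau> \<gamma> L r. norm \<nu> = 1 \<and> norm \<tau> = 1 \<and> \<nu> \<bullet> \<tau> = 0 \<and>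
        L-lipschitz_on UNIV (\<gamma> :: real \<Rightarrow> real) \<and> r > 0 \<and>
        (\<forall>y\<in>ball x r. y \<in> S \<longleftrightarrow> \<gamma> (y \<bullet> \<tau>) < y \<bullet> \<nu>))"

definition polygonal_boundary :: "(real^2) set \<Rightarrow> bool" where
  "polygonal_boundary S \<longleftrightarrow>
     (\<exists>P. finite P \<and> frontier S = (\<Union>(a, b)\<in>P. closed_segment a b))"

definition polygonal_lipschitz_domain :: "(real^2) set \<Rightarrow> bool" where
  "polygonal_lipschitz_domain S \<longleftrightarrow> bounded S \<and> lipschitz_domain S \<and> polygonal_boundary S"

definition triangulation_of :: "(real^2) set set \<Rightarrow> (real^2) set \<Rightarrow> bool" where
  "triangulation_of \<T> S \<longleftrightarrow> triangulation \<T> \<and> (\<forall>K\<in>\<T>. 2 simplex K) \<and> \<Union>\<T> = S"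

definition vertices :: "(real^2) set set \<Rightarrow> (real^2) set" where
  "vertices \<T> = {z. \<exists>K\<in>\<T>. z extreme_point_of K}"

definition edges :: "(real^2) set set \<Rightarrow> (real^2) set set" where
  "edges \<T> = {e. \<exists>K\<in>\<T>. e edge_of K}"

definition endpoints :: "(real^2) set \<Rightarrow> (real^2) set" where
  "endpoints e = {z. z extreme_point_of e}"

definition mesh_size :: "(real^2) set set \<Rightarrow> real" where
  "mesh_size \<T> = Max (diameter ` \<T>)"

definition inball_diameter :: "(real^2) set \<Rightarrow> real" where
  "inball_diameter K = Sup {2 * r | r. r > 0 \<and> (\<exists>x. cball x r \<subseteq> K)}"

definition shape_regular :: "real \<Rightarrow> (real^2) set set \<Rightarrow> bool" where
  "shape_regular \<kappa> \<T> \<longleftrightarrow> (\<forall>K\<in>\<T>. diameter K \<le> \<kappa> * inball_diameter K)"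

definition quasi_uniform :: "real \<Rightarrow> (real^2) set set \<Rightarrow> bool" where
  "quasi_uniform \<kappa> \<T> \<longleftrightarrow> shape_regular \<kappa> \<T> \<and> (\<forall>K\<in>\<T>. mesh_size \<T> \<le> \<kappa> * diameter K)"


section \<open>Piecewise functions, traces and jumps\<close>

text \<open>In two dimensions every \<open>H\<^sup>2\<close> function on a triangle has a representative that is
  continuous up to the boundary. Piecewise functions are represented by the function that has
  these values in the open triangles and vanishes elsewhere, so that equality of
  classes is equality of functions.\<close>

definition zero_on_skeleton :: "(real^2) set set \<Rightarrow> fn \<Rightarrow> bool" where
  "zero_on_skeleton \<T> v \<longleftrightarrow> (\<forall>x. x \<notin> (\<Union>K\<in>\<T>. interior K) \<longrightarrow> v x = 0)"

definition broken_H2 :: "(real^2) set set \<Rightarrow> fn set" where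
  "broken_H2 \<T> = {v. zero_on_skeleton \<T> v \<and>
     (\<forall>K\<in>\<T>. v \<in> H2 (interior K) \<and>
        (\<exists>g. continuous_on K g \<and> (\<forall>x\<in>interior K. v x = g x)))}"

definition polynomial2 :: "nat \<Rightarrow> fn \<Rightarrow> bool" where
  "polynomial2 r p \<longleftrightarrow>
     (\<exists>c. \<forall>x. p x = (\<Sum>i\<le>r. \<Sum>j\<le>r - i. c i j * (x $ 1) ^ i * (x $ 2) ^ j))"

definition broken_poly :: "nat \<Rightarrow> (real^2) set set \<Rightarrow> fn set" where
  "broken_poly r \<T> = {v. zero_on_skeleton \<T> v \<and>
     (\<forall>K\<in>\<T>. \<exists>p. polynomial2 r p \<and> (\<forall>x\<in>interior K. v x = p x))}"

text \<open>The value at \<open>z\<close> of the restriction of \<open>g\<close> to \<open>K\<close>.\<close>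

definition tr :: "(real^2) set \<Rightarrow> (real^2 \<Rightarrow> 'b::t2_space) \<Rightarrow> real^2 \<Rightarrow> 'b" where
  "tr K g z = Lim (at z within interior K) g"

definition patch :: "(real^2) set set \<Rightarrow> real^2 \<Rightarrow> (real^2) set set" where
  "patch \<T> z = {K\<in>\<T>. z \<in> K}"

definition adj :: "(real^2) set set \<Rightarrow> (real^2) set \<Rightarrow> (real^2) set set" where
  "adj \<T> e = {K\<in>\<T>. e edge_of K}"

text \<open>The orientation of the jump and of the normal is fixed by choice. For a boundary edge
  \<open>adj \<T> e\<close> is a singleton, and the jump and the average are both the trace.\<close>

definition jump :: "(real^2) set set \<Rightarrow> (real^2) set \<Rightarrow> ((real^2) set \<Rightarrow> real) \<Rightarrow> real" where
  "jump \<T> e g = (let K = (SOME K. K \<in> adj \<T> e) in g K - (\<Sum>L\<in>adj \<T> e - {K}. g L))"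

definition average :: "(real^2) set set \<Rightarrow> (real^2) set \<Rightarrow> ((real^2) set \<Rightarrow> real) \<Rightarrow> real" where
  "average \<T> e g = (\<Sum>K\<in>adj \<T> e. g K) / real (card (adj \<T> e))"

definition edge_normal :: "(real^2) set \<Rightarrow> real^2" where
  "edge_normal e = (SOME \<nu>. norm \<nu> = 1 \<and> (\<forall>x\<in>e. \<forall>y\<in>e. \<nu> \<bullet> (x - y) = 0))"

definition edge_midpoint :: "(real^2) set \<Rightarrow> real^2" where
  "edge_midpoint e = (\<Sum>z\<in>endpoints e. z) /\<^sub>R 2"

definition edge_integral :: "(real^2) set \<Rightarrow> fn \<Rightarrow> real" where
  "edge_integral e g = (let (a, b) = (SOME (a, b). e = closed_segment a b)
     in dist a b * integral {0..1} (\<lambda>t. g (linepath a b t)))"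

text \<open>The integral over \<open>e\<close> of the trace of the normal derivative of the restriction of \<open>v\<close> to
  \<open>K\<close>: the value at \<open>v\<close> of the continuous extension of \<open>\<phi> \<mapsto> \<integral>\<^sub>e \<partial>\<phi>/\<partial>n ds\<close> from
  smooth functions to \<open>H\<^sup>2(K)\<close>.\<close>

definition edge_flux :: "(real^2) set \<Rightarrow> (real^2) set \<Rightarrow> fn \<Rightarrow> real" where
  "edge_flux K e v = (THE I. \<exists>\<phi>. (\<forall>j::nat. smooth (\<phi> j)) \<and>
     (\<lambda>j. h2_norm (interior K) (\<lambda>x. \<phi> j x - v x)) \<longlonglongrightarrow> 0 \<and>
     (\<lambda>j. edge_integral e (\<lambda>x. grad (\<phi> j) x \<bullet> edge_normal e)) \<longlonglongrightarrow> I)"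

definition h_norm :: "(real^2) set set \<Rightarrow> fn \<Rightarrow> real" where
  "h_norm \<T> v = sqrt (
     (\<Sum>K\<in>\<T>. (h2_seminorm (interior K) v)\<^sup>2)
   + (\<Sum>e\<in>edges \<T>. \<Sum>z\<in>endpoints e. \<bar>jump \<T> e (\<lambda>K. tr K v z)\<bar>\<^sup>2 / (diameter e)\<^sup>2)
   + (\<Sum>e\<in>edges \<T>. \<bar>jump \<T> e (\<lambda>K. edge_flux K e v) / diameter e\<bar>\<^sup>2))"


section \<open>Discrete spaces and operators\<close>

definition morley :: "(real^2) set \<Rightarrow> (real^2) set set \<Rightarrow> fn set" where
  "morley \<Omega> \<T> = {v \<in> broken_poly 2 \<T>.
     (\<forall>z\<in>vertices \<T>. \<forall>K\<in>patch \<T> z. \<forall>L\<in>patch \<T> z.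
        (z \<in> \<Omega> \<longrightarrow> tr K v z = tr L v z) \<and> (z \<in> frontier \<Omega> \<longrightarrow> tr K v z = 0)) \<and>
     (\<forall>e\<in>edges \<T>. \<forall>K\<in>adj \<T> e. \<forall>L\<in>adj \<T> e.
        (let dn = (\<lambda>K. tr K (grad v) (edge_midpoint e) \<bullet> edge_normal e) in
           (\<not> e \<subseteq> frontier \<Omega> \<longrightarrow> dn K = dn L) \<and> (e \<subseteq> frontier \<Omega> \<longrightarrow> dn K = 0)))}"

definition fin_dim_subspace :: "fn set \<Rightarrow> bool" where
  "fin_dim_subspace V \<longleftrightarrow> (\<exists>B. finite B \<and> V = {(\<lambda>x. \<Sum>b\<in>B. c b * b x) | c. True})"

definition space_sum :: "fn set \<Rightarrow> fn set \<Rightarrow> fn set" where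
  "space_sum V W = {(\<lambda>x. v x + w x) | v w. v \<in> V \<and> w \<in> W}"

definition linear_comb :: "real \<Rightarrow> fn \<Rightarrow> real \<Rightarrow> fn \<Rightarrow> fn" where
  "linear_comb c v d w = (\<lambda>x. c * v x + d * w x)"

definition symmetric_bilinear_on :: "fn set \<Rightarrow> (fn \<Rightarrow> fn \<Rightarrow> real) \<Rightarrow> bool" where
  "symmetric_bilinear_on W b \<longleftrightarrow>
     (\<forall>v\<in>W. \<forall>w\<in>W. b v w = b w v) \<and>
     (\<forall>c d. \<forall>v\<in>W. \<forall>w\<in>W. \<forall>y\<in>W. b (linear_comb c v d w) y = c * b v y + d * b w y)"

definition morley_interpolation ::
  "(real^2) set \<Rightarrow> (real^2) set set \<Rightarrow> (fn \<Rightarrow> fn) \<Rightarrow> bool" where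
  "morley_interpolation \<Omega> \<T> I\<^sub>M \<longleftrightarrow> (\<forall>v\<in>broken_H2 \<T>.
     I\<^sub>M v \<in> morley \<Omega> \<T> \<and>
     (\<forall>z\<in>vertices \<T> \<inter> \<Omega>. \<forall>K\<in>patch \<T> z.
        tr K (I\<^sub>M v) z = (\<Sum>L\<in>patch \<T> z. tr L v z) / real (card (patch \<T> z))) \<and>
     (\<forall>e\<in>edges \<T>. \<not> e \<subseteq> frontier \<Omega> \<longrightarrow>
        (\<forall>K\<in>adj \<T> e. edge_flux K e (I\<^sub>M v) = average \<T> e (\<lambda>L. edge_flux L e v))))"

text \<open>The Hsieh--Clough--Tocher space: each triangle is split at its centroid into three.
  Conformity in \<open>H\<^sup>2\<close> makes these piecewise cubics continuously differentiable.\<close>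

definition centroid :: "(real^2) set \<Rightarrow> real^2" where
  "centroid K = (\<Sum>z | z extreme_point_of K. z) /\<^sub>R 3"

definition hct :: "(real^2) set \<Rightarrow> (real^2) set set \<Rightarrow> fn set" where
  "hct \<Omega> \<T> = {v \<in> H20 \<Omega>. \<forall>K\<in>\<T>. \<forall>e. e edge_of K \<longrightarrow>
     (\<exists>p. polynomial2 3 p \<and>
        (AE x in lebesgue_on (convex hull (insert (centroid K) e)). v x = p x))}"

text \<open>The values of the companion operator are represented by continuous functions, extended
  by zero outside \<open>\<Omega>\<close>; so their point values are meaningful and linearity holds pointwise.\<close>

definition companion_operator ::
  "(real^2) set \<Rightarrow> (real^2) set set \<Rightarrow> (fn \<Rightarrow> fn) \<Rightarrow> bool" where
  "companion_operator \<Omega> \<T> J \<longleftrightarrow>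
     (\<forall>c d. \<forall>v\<in>morley \<Omega> \<T>. \<forall>w\<in>morley \<Omega> \<T>.
        J (linear_comb c v d w) = linear_comb c (J v) d (J w)) \<and>
     (\<forall>w\<in>morley \<Omega> \<T>.
        J w \<in> H20 \<Omega> \<and> continuous_on UNIV (J w) \<and> (\<forall>x. x \<notin> \<Omega> \<longrightarrow> J w x = 0) \<and>
        (\<exists>p\<in>hct \<Omega> \<T>. \<exists>q\<in>broken_poly 8 \<T>. AE x in lebesgue_on \<Omega>. J w x = p x + q x) \<and>
        (\<forall>z\<in>vertices \<T>. \<forall>K\<in>patch \<T> z. J w z = tr K w z) \<and>
        (\<forall>z\<in>vertices \<T> \<inter> \<Omega>.
           GDERIV (J w) z :> (\<Sum>K\<in>patch \<T> z. tr K (grad w) z) /\<^sub>R real (card (patch \<T> z))) \<and>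
        (\<forall>e\<in>edges \<T>. \<forall>K\<in>adj \<T> e. edge_flux K e (J w) = edge_flux K e w))"

definition modified_ritz ::
  "(real^2) set \<Rightarrow> fn set \<Rightarrow> (fn \<Rightarrow> fn \<Rightarrow> real) \<Rightarrow> (fn \<Rightarrow> fn) \<Rightarrow> (fn \<Rightarrow> fn) \<Rightarrow> bool" where
  "modified_ritz \<Omega> V a\<^sub>h Q R\<^sub>h \<longleftrightarrow> (\<forall>w\<in>H20 \<Omega>.
     R\<^sub>h w \<in> V \<and> (\<forall>v\<in>V. a\<^sub>h (R\<^sub>h w) v = plate_form \<Omega> w (Q v)))"


section \<open>Functions of time\<close>

definition bochner_measurable :: "real \<Rightarrow> (real^2) set \<Rightarrow> (real \<Rightarrow> fn) \<Rightarrow> bool" where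
  "bochner_measurable T \<Omega> f \<longleftrightarrow>
     (\<exists>s :: nat \<Rightarrow> real \<Rightarrow> fn.
        (\<forall>i. finite (s i ` {0<..<T}) \<and> s i ` {0<..<T} \<subseteq> L2 \<Omega> \<and>
             (\<forall>g. {t\<in>{0<..<T}. s i t = g} \<in> sets lebesgue)) \<and>
        (AE t in lebesgue_on {0<..<T}. (\<lambda>i. l2_norm \<Omega> (\<lambda>x. s i t x - f t x)) \<longlonglongrightarrow> 0))"

definition L2_L2 :: "real \<Rightarrow> (real^2) set \<Rightarrow> (real \<Rightarrow> fn) set" where
  "L2_L2 T \<Omega> = {f. (\<forall>t\<in>{0..T}. f t \<in> L2 \<Omega>) \<and> bochner_measurable T \<Omega> f \<and>
     integrable (lebesgue_on {0<..<T}) (\<lambda>t. (l2_norm \<Omega> (f t))\<^sup>2)}"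

definition Linf_L2_norm :: "real \<Rightarrow> (real^2) set \<Rightarrow> (real \<Rightarrow> fn) \<Rightarrow> ereal" where
  "Linf_L2_norm T \<Omega> f = esssup (lebesgue_on {0<..<T}) (\<lambda>t. ereal (l2_norm \<Omega> (f t)))"

definition L2_continuous_at :: "real \<Rightarrow> (real^2) set \<Rightarrow> (real \<Rightarrow> fn) \<Rightarrow> real \<Rightarrow> bool" where
  "L2_continuous_at T \<Omega> f t \<longleftrightarrow>
     ((\<lambda>s. l2_norm \<Omega> (\<lambda>x. f s x - f t x)) \<longlongrightarrow> 0) (at t within {0..T})"

text \<open>\<open>half \<phi> n\<close> and \<open>dt k \<phi> n\<close> belong to the index \<open>n + 1/2\<close>; \<open>d2t k \<phi> n\<close> is meant for
  \<open>n \<ge> 1\<close>.\<close>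

definition half :: "(nat \<Rightarrow> fn) \<Rightarrow> nat \<Rightarrow> fn" where
  "half \<phi> n = (\<lambda>x. (\<phi> (n + 1) x + \<phi> n x) / 2)"

definition dt :: "real \<Rightarrow> (nat \<Rightarrow> fn) \<Rightarrow> nat \<Rightarrow> fn" where
  "dt k \<phi> n = (\<lambda>x. (\<phi> (n + 1) x - \<phi> n x) / k)"

definition d2t :: "real \<Rightarrow> (nat \<Rightarrow> fn) \<Rightarrow> nat \<Rightarrow> fn" where
  "d2t k \<phi> n = (\<lambda>x. (\<phi> (n + 1) x - 2 * \<phi> n x + \<phi> (n - 1) x) / k\<^sup>2)"


section \<open>The explicit scheme\<close>

definition first_step ::
  "(real^2) set \<Rightarrow> fn set \<Rightarrow> (fn \<Rightarrow> fn \<Rightarrow> real) \<Rightarrow> real \<Rightarrow> (nat \<Rightarrow> fn) \<Rightarrow> fn \<Rightarrow> (nat \<Rightarrow> fn) \<Rightarrow> bool" where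
  "first_step \<Omega> V a\<^sub>h k F v\<^sub>0 U \<longleftrightarrow> (\<forall>v\<in>V.
     2 / k * l2_inner \<Omega> (dt k U 0) v + a\<^sub>h (half U 0) v
       = l2_inner \<Omega> (\<lambda>x. half F 0 x + 2 / k * v\<^sub>0 x) v)"

definition explicit_steps ::
  "(real^2) set \<Rightarrow> fn set \<Rightarrow> (fn \<Rightarrow> fn \<Rightarrow> real) \<Rightarrow> real \<Rightarrow> nat \<Rightarrow> (nat \<Rightarrow> fn) \<Rightarrow> (nat \<Rightarrow> fn) \<Rightarrow> bool" where
  "explicit_steps \<Omega> V a\<^sub>h k N F U \<longleftrightarrow> (\<forall>n\<in>{1..<N}. \<forall>v\<in>V.
     l2_inner \<Omega> (d2t k U n) v + a\<^sub>h (U n) v = l2_inner \<Omega> (F n) v)"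

definition energy_norm ::
  "(real^2) set \<Rightarrow> (real^2) set set \<Rightarrow> real \<Rightarrow> (nat \<Rightarrow> fn) \<Rightarrow> nat \<Rightarrow> real" where
  "energy_norm \<Omega> \<T> k U m = l2_norm \<Omega> (dt k U m) + h_norm \<T> (half U m)"

text \<open>Stability: discrete solutions depend Lipschitz continuously, with constant \<open>C\<close>, on
  their starting values and on the source at the grid times.\<close>

definition stable_scheme ::
  "real \<Rightarrow> (real^2) set \<Rightarrow> (real^2) set set \<Rightarrow> fn set \<Rightarrow> (fn \<Rightarrow> fn \<Rightarrow> real) \<Rightarrow> real \<Rightarrow> nat \<Rightarrow> bool" where
  "stable_scheme C \<Omega> \<T> V a\<^sub>h k N \<longleftrightarrow> (\<forall>U W F G.
     (\<forall>n\<le>N. U n \<in> V \<and> W n \<in> V \<and> F n \<in> L2 \<Omega> \<and> G n \<in> L2 \<Omega>) \<and>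
     explicit_steps \<Omega> V a\<^sub>h k N F U \<and> explicit_steps \<Omega> V a\<^sub>h k N G W \<longrightarrow>
     (\<forall>m\<in>{1..<N}. energy_norm \<Omega> \<T> k (\<lambda>n x. U n x - W n x) m
        \<le> C * (energy_norm \<Omega> \<T> k (\<lambda>n x. U n x - W n x) 0
               + (MAX n\<in>{1..<N}. l2_norm \<Omega> (\<lambda>x. F n x - G n x)))))"

end

theory Submission
  imports Defs
begin

text \<open>
  Testing the scheme with \<open>v = D\<^sub>n + D\<^sub>n\<^sub>-\<^sub>1\<close>, where \<open>D\<^sub>n = (U\<^sub>n\<^sub>+\<^sub>1 - U\<^sub>n) / k\<close>, shows that the discrete
  energy \<open>E\<^sub>n = (D\<^sub>n, D\<^sub>n) + a\<^sub>h(U\<^sub>n\<^sub>+\<^sub>1, U\<^sub>n)\<close> satisfies \<open>E\<^sub>n - E\<^sub>n\<^sub>-\<^sub>1 = k (F\<^sub>n, D\<^sub>n + D\<^sub>n\<^sub>-\<^sub>1)\<close>.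
  With \<open>H\<^sub>n = (U\<^sub>n\<^sub>+\<^sub>1 + U\<^sub>n) / 2\<close> one has \<open>a\<^sub>h(U\<^sub>n\<^sub>+\<^sub>1, U\<^sub>n) = a\<^sub>h(H\<^sub>n, H\<^sub>n) - (k\<^sup>2/4) a\<^sub>h(D\<^sub>n, D\<^sub>n)\<close>, and the
  CFL condition with the inverse inequality gives \<open>k\<^sup>2 a\<^sub>h(D\<^sub>n, D\<^sub>n) \<le> (D\<^sub>n, D\<^sub>n)\<close>. Hence \<open>E\<^sub>n\<close> controls
  \<open>\<parallel>D\<^sub>n\<parallel>\<^sup>2\<close> and \<open>\<parallel>H\<^sub>n\<parallel>\<^sub>h\<^sup>2\<close>, and \<open>\<surd>E\<^sub>n\<close> grows by at most \<open>2 k \<parallel>F\<^sub>n\<parallel>\<close> per step.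
\<close>

section \<open>Positive semidefinite forms on spaces of functions\<close>

text \<open>Used for \<open>l2_inner\<close> on \<open>L2\<close> and for \<open>a\<^sub>h\<close>
  on \<open>V\<close>. Only semidefiniteness is asked for, because functions that agree almost
  everywhere are not identified.\<close>

locale psd_form =
  fixes W :: "fn set" and b :: "fn \<Rightarrow> fn \<Rightarrow> real"
  assumes closed: "\<And>c d v w. v \<in> W \<Longrightarrow> w \<in> W \<Longrightarrow> linear_comb c v d w \<in> W"
    and bilinear: "symmetric_bilinear_on W b"
    and nonneg: "\<And>v. v \<in> W \<Longrightarrow> 0 \<le> b v v"
begin

lemma sym: "v \<in> W \<Longrightarrow> w \<in> W \<Longrightarrow> b v w = b w v"
  using bilinear by (auto simp: symmetric_bilinear_on_def)

lemma comb_left: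
  "v \<in> W \<Longrightarrow> w \<in> W \<Longrightarrow> y \<in> W \<Longrightarrow> b (linear_comb c v d w) y = c * b v y + d * b w y"
  using bilinear by (auto simp: symmetric_bilinear_on_def)

lemma comb_right:
  "v \<in> W \<Longrightarrow> w \<in> W \<Longrightarrow> y \<in> W \<Longrightarrow> b y (linear_comb c v d w) = c * b y v + d * b y w"
  by (metis closed comb_left sym)

text \<open>The form is nonnegative at c v - d w for all real c and d. A vector with
  \<open>b w w = 0\<close> may be nonzero, so this case is separate.\<close>

lemma Cauchy_Schwarz:
  assumes v: "v \<in> W" and w: "w \<in> W"
  shows "b v w \<le> sqrt (b v v) * sqrt (b w w)"
proof -
  have quad: "0 \<le> c\<^sup>2 * b v v - 2 * c * d * b v w + d\<^sup>2 * b w w" for c d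
  proof -
    have "0 \<le> b (linear_comb c v (-d) w) (linear_comb c v (-d) w)"
      by (intro nonneg closed v w)
    also have "\<dots> = c\<^sup>2 * b v v - 2 * c * d * b v w + d\<^sup>2 * b w w"
      using v w by (simp add: comb_left comb_right closed sym[of w v] power2_eq_square algebra_simps)
    finally show ?thesis .
  qed
  have "(b v w)\<^sup>2 \<le> b v v * b w w"
  proof (cases "b w w = 0")
    case True
    have "b v w = 0"
    proof (rule ccontr)
      assume ne: "b v w \<noteq> 0"
      \<comment> \<open>This value of d turns the right-hand side into -1.\<close>
      have "0 \<le> b v v - 2 * ((b v v + 1) / (2 * b v w)) * b v w"
        using quad[of 1 "(b v v + 1) / (2 * b v w)"] True by simp
      then show False using ne by simp
    qed
    then show ?thesis using True by simp
  next
    case False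
    then have pos: "b w w > 0" using nonneg[OF w] by simp
    \<comment> \<open>The choice c = \<open>b w w\<close>, d = \<open>b v w\<close> is the
      orthogonal projection, scaled to avoid division.\<close>
    have "0 \<le> b w w * (b v v * b w w - (b v w)\<^sup>2)"
      using quad[of "b w w" "b v w"] by (simp add: power2_eq_square algebra_simps)
    then show ?thesis using pos by (simp add: zero_le_mult_iff)
  qed
  then have "\<bar>b v w\<bar> \<le> sqrt (b v v * b w w)"
    by (metis real_sqrt_abs real_sqrt_le_iff)
  then show ?thesis by (simp add: real_sqrt_mult)
qed

end

text \<open>Closedness and bilinearity are stated for \<open>linear_comb\<close>, so differences,
  means and difference quotients are brought into this form.\<close>

lemma diff_eq_linear_comb: "(\<lambda>x. v x - w x) = linear_comb 1 v (-1) w"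
  by (simp add: linear_comb_def)

lemma half_eq_linear_comb: "half U n = linear_comb (1/2) (U (n + 1)) (1/2) (U n)"
  by (auto simp: half_def linear_comb_def field_simps)

lemma dt_eq_linear_comb: "dt k U n = linear_comb (1/k) (U (n + 1)) (-(1/k)) (U n)"
  by (auto simp: dt_def linear_comb_def diff_divide_distrib)

text \<open>The second difference is the difference quotient of first ones. At \<open>Suc n\<close>
  the truncated subtraction in \<open>d2t\<close> is a true predecessor.\<close>

lemma d2t_eq_linear_comb:
  "k \<noteq> 0 \<Longrightarrow> d2t k U (Suc n) = linear_comb (1/k) (dt k U (Suc n)) (-(1/k)) (dt k U n)"
  by (auto simp: dt_def d2t_def linear_comb_def field_simps power2_eq_square)

section \<open>The discrete energy estimate\<close>

text \<open>Cancelling p + q in p^2 - q^2 = (p - q)(p + q) makes the root of the energy grow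
  additively, so no exponential Gronwall factor arises.\<close>

lemma sqrt_step:
  fixes p q c :: real
  assumes "0 \<le> p" "0 \<le> q" "0 \<le> c" and le: "p\<^sup>2 - q\<^sup>2 \<le> c * (p + q)"
  shows "p \<le> q + c"
proof (rule ccontr)
  assume "\<not> p \<le> q + c"
  then have "p - q > c" "p + q > 0" using assms by auto
  then have "(p - q) * (p + q) > c * (p + q)" by simp
  then show False using le by (simp add: power2_eq_square algebra_simps)
qed

text \<open>The mesh enters only through the abstract forms, so the constant depends on \<alpha>,
  \<beta> and T alone. Its first factor passes from the root of the energy back to the two norms;
  its second bounds that root by initial values and source.\<close>

lemma leapfrog_energy_bound:
  fixes L V :: "fn set" and ip a :: "fn \<Rightarrow> fn \<Rightarrow> real" and nh :: "fn \<Rightarrow> real"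
  assumes ip: "psd_form L ip" and a: "psd_form V a" and VL: "V \<subseteq> L"
    and ab: "\<alpha> > 0" "\<beta> > 0" and k: "k > 0" and kT: "real N * k \<le> T"
    and nh: "\<And>v. 0 \<le> nh v"
    and coercive: "\<And>v. v \<in> V \<Longrightarrow> \<alpha> * (nh v)\<^sup>2 \<le> a v v"
    and bounded: "\<And>v. v \<in> V \<Longrightarrow> a v v \<le> \<beta> * (nh v)\<^sup>2"
    and CFL: "\<And>v. v \<in> V \<Longrightarrow> k\<^sup>2 * a v v \<le> ip v v"
    and U: "\<And>n. n \<le> N \<Longrightarrow> U n \<in> V"
    and F: "\<And>n. n \<in> {1..<N} \<Longrightarrow> F n \<in> L \<and> sqrt (ip (F n) (F n)) \<le> M"
    and scheme: "\<And>n v. n \<in> {1..<N} \<Longrightarrow> v \<in> V \<Longrightarrow> ip (d2t k U n) v + a (U n) v = ip (F n) v"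
    and m: "m \<in> {1..<N}"
  shows "sqrt (ip (dt k U m) (dt k U m)) + nh (half U m)
    \<le> (2 + 1 / sqrt \<alpha>) * (1 + sqrt \<beta> + 2 * T) *
      (sqrt (ip (dt k U 0) (dt k U 0)) + nh (half U 0) + M)"
proof -
  interpret ip: psd_form L ip by (rule ip)
  interpret a: psd_form V a by (rule a)
  define D where "D n = dt k U n" for n
  define H where "H n = half U n" for n
  define E where "E n = ip (D n) (D n) + a (U (Suc n)) (U n)" for n
  have DV: "D n \<in> V" and HV: "H n \<in> V" if "n < N" for n
    using that U by (auto simp: D_def H_def dt_eq_linear_comb half_eq_linear_comb intro!: a.closed)
  have DL: "D n \<in> L" if "n < N" for n using DV[OF that] VL by auto
  \<comment> \<open>The index m shows that the range of indices is nonempty, so M bounds some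
    norm.\<close>
  have M: "0 \<le> M" using F[OF m] ip.nonneg[of "F m"] by (meson order_trans real_sqrt_ge_zero)
  have E_eq: "E n = ip (D n) (D n) + a (H n) (H n) - k\<^sup>2 / 4 * a (D n) (D n)" if "n < N" for n
  proof -
    have UV: "U n \<in> V" "U (Suc n) \<in> V" using U that by auto
    have "a (D n) (D n) = (a (U (Suc n)) (U (Suc n)) - 2 * a (U (Suc n)) (U n) + a (U n) (U n)) / k\<^sup>2"
      using UV by (simp add: D_def dt_eq_linear_comb a.comb_left a.comb_right a.closed
          a.sym[of "U n" "U (Suc n)"] power2_eq_square diff_divide_distrib add_divide_distrib)
    moreover have "a (H n) (H n) = (a (U (Suc n)) (U (Suc n)) + 2 * a (U (Suc n)) (U n) + a (U n) (U n)) / 4"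
      using UV by (simp add: H_def half_eq_linear_comb a.comb_left a.comb_right a.closed
          a.sym[of "U n" "U (Suc n)"] field_simps)
    ultimately show ?thesis using k by (simp add: E_def field_simps)
  qed
  \<comment> \<open>The hypothesis \<open>CFL\<close> lets the negative term consume at most a
    quarter of \<open>ip (D n) (D n)\<close>.\<close>
  have E_lower: "3/4 * ip (D n) (D n) + \<alpha> * (nh (H n))\<^sup>2 \<le> E n" if "n < N" for n
    using E_eq[OF that] CFL[OF DV[OF that]] coercive[OF HV[OF that]] by simp
  have D_le: "sqrt (ip (D n) (D n)) \<le> 2 * sqrt (E n)"
    and H_le: "sqrt \<alpha> * nh (H n) \<le> sqrt (E n)" and E_nonneg: "0 \<le> E n" if "n < N" for n
  proof -
    have 1: "0 \<le> ip (D n) (D n)" "0 \<le> \<alpha> * (nh (H n))\<^sup>2"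
      using ip.nonneg DL[OF that] ab by auto
    then show "0 \<le> E n" using E_lower[OF that] by linarith
    \<comment> \<open>The factor 4/3 would do; 4 has a rational root.\<close>
    have "ip (D n) (D n) \<le> 4 * E n" using E_lower[OF that] 1 by linarith
    then have "sqrt (ip (D n) (D n)) \<le> sqrt (4 * E n)" by simp
    then show "sqrt (ip (D n) (D n)) \<le> 2 * sqrt (E n)" by (simp add: real_sqrt_mult)
    have "\<alpha> * (nh (H n))\<^sup>2 \<le> E n" using E_lower[OF that] 1 by linarith
    then have "sqrt (\<alpha> * (nh (H n))\<^sup>2) \<le> sqrt (E n)" by simp
    then show "sqrt \<alpha> * nh (H n) \<le> sqrt (E n)" using nh by (simp add: real_sqrt_mult)
  qed
  have E_step: "E (Suc n) - E n = k * ip (F (Suc n)) (linear_comb 1 (D (Suc n)) 1 (D n))"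
    if n: "Suc n < N" for n
  proof -
    let ?v = "linear_comb 1 (D (Suc n)) 1 (D n)"
    have UV: "U n \<in> V" "U (Suc n) \<in> V" "U (Suc (Suc n)) \<in> V" using U n by auto
    have DLs: "D n \<in> L" "D (Suc n) \<in> L" using DL n by auto
    have vV: "?v \<in> V" using DV n by (intro a.closed) auto
    \<comment> \<open>The test function is also (U(n+2) - U(n)) / k, so the \<open>a\<close> term
      telescopes, while as a sum of D's it makes the \<open>ip\<close> term a difference of
      squares.\<close>
    have v_eq: "?v = linear_comb (1/k) (U (Suc (Suc n))) (-(1/k)) (U n)"
      by (auto simp: D_def dt_def linear_comb_def diff_divide_distrib)
    have "k * ip (d2t k U (Suc n)) ?v = ip (D (Suc n)) (D (Suc n)) - ip (D n) (D n)"
      using DLs k d2t_eq_linear_comb[of k U n, folded D_def]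
      by (simp add: ip.comb_left ip.comb_right ip.closed ip.sym[of "D n" "D (Suc n)"] field_simps)
    moreover have "k * a (U (Suc n)) ?v = a (U (Suc (Suc n))) (U (Suc n)) - a (U (Suc n)) (U n)"
      unfolding v_eq using UV k
      by (simp add: a.comb_right a.sym[of "U (Suc n)" "U (Suc (Suc n))"] field_simps)
    moreover have "k * (ip (d2t k U (Suc n)) ?v + a (U (Suc n)) ?v) = k * ip (F (Suc n)) ?v"
      using scheme[OF _ vV, of "Suc n"] n by simp
    ultimately show ?thesis by (simp add: E_def algebra_simps)
  qed
  have step: "sqrt (E (Suc n)) \<le> sqrt (E n) + 2 * k * M" if n: "Suc n < N" for n
  proof (rule sqrt_step)
    have nN: "n < N" using n by simp
    have FL: "F (Suc n) \<in> L" "sqrt (ip (F (Suc n)) (F (Suc n))) \<le> M" using F n by auto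
    have CS: "ip (F (Suc n)) (D j) \<le> M * (2 * sqrt (E j))" if "j < N" for j
    proof -
      have "ip (F (Suc n)) (D j) \<le> sqrt (ip (F (Suc n)) (F (Suc n))) * sqrt (ip (D j) (D j))"
        by (intro ip.Cauchy_Schwarz FL DL that)
      also have "\<dots> \<le> M * (2 * sqrt (E j))"
        using FL D_le[OF that] M ip.nonneg[OF DL[OF that]] by (intro mult_mono) auto
      finally show ?thesis .
    qed
    have "E (Suc n) - E n = k * (ip (F (Suc n)) (D (Suc n)) + ip (F (Suc n)) (D n))"
      using E_step[OF n] FL DL n by (simp add: ip.comb_right)
    also have "\<dots> \<le> k * (M * (2 * sqrt (E (Suc n))) + M * (2 * sqrt (E n)))"
      using CS[OF n] CS[OF nN] k by (intro mult_left_mono add_mono) auto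
    \<comment> \<open>The factor 2 comes from \<open>D_le\<close>; it gives the increment 2 k M of
      the root.\<close>
    finally show "(sqrt (E (Suc n)))\<^sup>2 - (sqrt (E n))\<^sup>2 \<le> 2 * k * M * (sqrt (E (Suc n)) + sqrt (E n))"
      using E_nonneg[OF n] E_nonneg[OF nN] by (simp add: algebra_simps)
  qed (use E_nonneg n k M in auto)
  have sum: "sqrt (E n) \<le> sqrt (E 0) + real n * (2 * k * M)" if "n < N" for n
    using that
  proof (induction n)
    case (Suc n)
    then show ?case using step[of n] by (simp add: algebra_simps)
  qed simp
  have mN: "m < N" and N0: "0 < N" using m by auto
  have E0: "sqrt (E 0) \<le> sqrt (ip (D 0) (D 0)) + sqrt \<beta> * nh (H 0)"
  proof -
    have n0: "0 \<le> ip (D 0) (D 0)" using ip.nonneg DL N0 by auto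
    \<comment> \<open>For the upper bound the subtracted term of \<open>E_eq\<close> is simply
      dropped.\<close>
    have "0 \<le> k\<^sup>2 / 4 * a (D 0) (D 0)" using a.nonneg[OF DV[OF N0]] by simp
    then have "E 0 \<le> ip (D 0) (D 0) + \<beta> * (nh (H 0))\<^sup>2"
      using E_eq[OF N0] bounded[OF HV[OF N0]] by linarith
    then have "sqrt (E 0) \<le> sqrt (ip (D 0) (D 0) + \<beta> * (nh (H 0))\<^sup>2)" by simp
    also have "\<dots> \<le> sqrt (ip (D 0) (D 0)) + sqrt (\<beta> * (nh (H 0))\<^sup>2)"
      using n0 ab by (intro sqrt_add_le_add_sqrt) auto
    finally show ?thesis using nh by (simp add: real_sqrt_mult)
  qed
  let ?X = "sqrt (ip (D 0) (D 0))" and ?Y = "nh (H 0)"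
  have X: "0 \<le> ?X" using ip.nonneg DL N0 by auto
  have T: "0 \<le> T" using kT k by (meson mult_nonneg_nonneg of_nat_0_le_iff less_imp_le order_trans)
  have "real m * k \<le> T"
    using mN k kT by (smt (verit) mult_right_mono of_nat_mono less_imp_le)
  \<comment> \<open>At most T / k increments of size 2 k M are added up, so k cancels.\<close>
  then have mk: "real m * (2 * k * M) \<le> 2 * T * M"
    using mult_right_mono[OF _ M, of "real m * k" T] by (simp add: algebra_simps)
  have "sqrt (E m) \<le> ?X + sqrt \<beta> * ?Y + 2 * T * M"
    using sum[OF mN] E0 mk by linarith
  also have "\<dots> \<le> (1 + sqrt \<beta> + 2 * T) * (?X + ?Y + M)"
  proof -
    \<comment> \<open>These are cross terms of the expanded product that are absent on the
      left.\<close>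
    have "0 \<le> sqrt \<beta> * ?X" "0 \<le> T * ?X" "0 \<le> T * ?Y" "0 \<le> sqrt \<beta> * M"
      using X M T nh[of "H 0"] ab by auto
    then show ?thesis using X M nh[of "H 0"] by (simp add: algebra_simps)
  qed
  finally have Em: "sqrt (E m) \<le> (1 + sqrt \<beta> + 2 * T) * (?X + ?Y + M)" .
  have "nh (H m) \<le> 1 / sqrt \<alpha> * sqrt (E m)"
    using H_le[OF mN] ab by (simp add: field_simps)
  then have "sqrt (ip (D m) (D m)) + nh (H m) \<le> (2 + 1 / sqrt \<alpha>) * sqrt (E m)"
    using D_le[OF mN] by (simp add: algebra_simps)
  also have "\<dots> \<le> (2 + 1 / sqrt \<alpha>) * ((1 + sqrt \<beta> + 2 * T) * (?X + ?Y + M))"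
    using ab by (intro mult_left_mono Em) (simp add: add_nonneg_nonneg)
  finally show ?thesis by (simp add: D_def H_def mult.assoc)
qed

section \<open>Square-integrable functions\<close>

text \<open>The product is dominated by the sum of the squares.\<close>

lemma integrable_mult_L2:
  assumes "g \<in> L2 S" "w \<in> L2 S"
  shows "integrable (lebesgue_on S) (\<lambda>x. g x * w x)"
proof (rule Bochner_Integration.integrable_bound)
  show "integrable (lebesgue_on S) (\<lambda>x. (g x)\<^sup>2 + (w x)\<^sup>2)"
    using assms by (auto simp: L2_def)
  show "(\<lambda>x. g x * w x) \<in> borel_measurable (lebesgue_on S)"
    using assms by (auto simp: L2_def)
  have "\<bar>g x * w x\<bar> \<le> (g x)\<^sup>2 + (w x)\<^sup>2" for x
  proof -
    have "2 * (\<bar>g x\<bar> * \<bar>w x\<bar>) \<le> (g x)\<^sup>2 + (w x)\<^sup>2"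
      using sum_squares_bound[of "\<bar>g x\<bar>" "\<bar>w x\<bar>"] by (simp add: mult.assoc)
    then show ?thesis
      using abs_ge_zero[of "g x * w x"] unfolding abs_mult by linarith
  qed
  then show "AE x in lebesgue_on S. norm (g x * w x) \<le> norm ((g x)\<^sup>2 + (w x)\<^sup>2)"
    by auto
qed

lemma psd_form_l2_inner: "psd_form (L2 S) (l2_inner S)"
proof
  fix c d v w assume vw: "v \<in> L2 S" "w \<in> L2 S"
  have "integrable (lebesgue_on S) (\<lambda>x. c\<^sup>2 * (v x)\<^sup>2 + 2 * c * d * (v x * w x) + d\<^sup>2 * (w x)\<^sup>2)"
    using vw integrable_mult_L2[OF vw] by (intro Bochner_Integration.integrable_add) (auto simp: L2_def)
  then have "integrable (lebesgue_on S) (\<lambda>x. (c * v x + d * w x)\<^sup>2)"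
    by (simp add: power2_eq_square algebra_simps)
  then show "linear_comb c v d w \<in> L2 S"
    using vw by (auto simp: L2_def linear_comb_def)
next
  show "symmetric_bilinear_on (L2 S) (l2_inner S)"
  proof (unfold symmetric_bilinear_on_def, intro conjI allI ballI)
    fix c d v w y assume *: "v \<in> L2 S" "w \<in> L2 S" "y \<in> L2 S"
    have "l2_inner S (linear_comb c v d w) y
      = (LINT x|lebesgue_on S. c * (v x * y x) + d * (w x * y x))"
      by (simp add: l2_inner_def linear_comb_def algebra_simps)
    also have "\<dots> = c * l2_inner S v y + d * l2_inner S w y"
      using integrable_mult_L2[OF *(1,3)] integrable_mult_L2[OF *(2,3)]
      by (simp add: l2_inner_def)
    finally show "l2_inner S (linear_comb c v d w) y = c * l2_inner S v y + d * l2_inner S w y" .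
  qed (simp add: l2_inner_def mult.commute)
qed (simp add: l2_inner_def)

lemma l2_inner_eq_norm: "l2_inner S v v = (l2_norm S v)\<^sup>2"
  by (simp add: l2_norm_def l2_inner_def)

text \<open>Expanding the square of w + (v - w) and applying Cauchy-Schwarz; it serves to compare
  the source at nearby times.\<close>

lemma l2_norm_le_add_diff:
  assumes "v \<in> L2 S" "w \<in> L2 S"
  shows "l2_norm S v \<le> l2_norm S w + l2_norm S (\<lambda>x. v x - w x)"
proof -
  interpret psd_form "L2 S" "l2_inner S" by (rule psd_form_l2_inner)
  define z where "z = (\<lambda>x. v x - w x)"
  have z: "z \<in> L2 S" unfolding z_def diff_eq_linear_comb by (intro closed assms)
  have v: "v = linear_comb 1 w 1 z" by (auto simp: z_def linear_comb_def)
  have "(l2_norm S v)\<^sup>2 = l2_inner S w w + 2 * l2_inner S w z + l2_inner S z z"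
    unfolding l2_inner_eq_norm[symmetric] v using assms z
    by (simp add: comb_left comb_right closed sym[of z w])
  also have "\<dots> \<le> (l2_norm S w + l2_norm S z)\<^sup>2"
    using Cauchy_Schwarz[OF assms(2) z]
    by (simp add: power2_sum l2_inner_eq_norm l2_norm_def[symmetric])
      (simp add: l2_norm_def l2_inner_def)
  finally show ?thesis unfolding z_def[symmetric]
    by (rule power2_le_imp_le) (simp add: l2_norm_def l2_inner_def)
qed

text \<open>Measurability and square integrability are pasted together from finitely many open
  triangles. Outside them the function is zero, so the result holds on any measurable
  \<open>S\<close>.\<close>

lemma broken_H2_subset_L2:
  assumes fin: "finite \<T>" and S: "S \<in> sets lebesgue"
  shows "broken_H2 \<T> \<subseteq> L2 S"
proof
  fix v assume v: "v \<in> broken_H2 \<T>"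
  let ?I = "\<Union>K\<in>\<T>. interior K"
  have vK: "v \<in> L2 (interior K)" if "K \<in> \<T>" for K
    using v that by (auto simp: broken_H2_def H2_def)
  have v0: "v x = 0" if "x \<notin> ?I" for x
    using v that unfolding broken_H2_def zero_on_skeleton_def by blast
  have I: "?I \<in> sets lebesgue" using fin by (intro sets.finite_UN) auto
  have meas: "v \<in> borel_measurable lebesgue"
  proof (rule measurable_piecewise_restrict[of "insert (- ?I) (interior ` \<T>)"])
    show "countable (insert (- ?I) (interior ` \<T>))" using fin by (auto intro: countable_finite)
    show "space lebesgue \<subseteq> \<Union> (insert (- ?I) (interior ` \<T>))" by auto
    fix A assume A: "A \<in> insert (- ?I) (interior ` \<T>)"
    show "A \<inter> space lebesgue \<in> sets lebesgue"
      using A I Compl_in_sets_lebesgue[of ?I] by (auto simp del: Compl_UN)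
    show "v \<in> borel_measurable (lebesgue_on A)"
    proof (cases "A = - ?I")
      case True
      have "(\<lambda>x. 0) \<in> borel_measurable (lebesgue_on A)" by simp
      moreover have "v x = 0" if "x \<in> space (lebesgue_on A)" for x
        using v0 that True by (simp add: space_restrict_space)
      ultimately show ?thesis by (subst measurable_cong[of _ _ "\<lambda>x. 0"]) auto
    next
      case False
      then show ?thesis using A vK by (auto simp: L2_def)
    qed
  qed
  have "set_integrable lebesgue ?I (\<lambda>x. (v x)\<^sup>2)"
  proof (rule set_integrable_UN[OF fin])
    fix K assume "K \<in> \<T>"
    then show "set_integrable lebesgue (interior K) (\<lambda>x. (v x)\<^sup>2)"
      using vK[of K] by (simp add: L2_def set_integrable_def integrable_restrict_space)
  qed auto
  moreover have "indicator ?I x *\<^sub>R (v x)\<^sup>2 = (v x)\<^sup>2" for x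
    using v0[of x] by (auto simp: indicator_def)
  ultimately have "integrable lebesgue (\<lambda>x. (v x)\<^sup>2)"
    unfolding set_integrable_def by (simp only:)
  then have "integrable (lebesgue_on S) (\<lambda>x. (v x)\<^sup>2)"
    using S integrable_mult_indicator[OF S, of "\<lambda>x. (v x)\<^sup>2"] by (simp add: integrable_restrict_space)
  then show "v \<in> L2 S"
    using measurable_restrict_space1[OF meas] by (auto simp: L2_def)
qed

text \<open>A point value above the essential supremum would, by continuity in time, persist on an
  interval of positive measure.\<close>

lemma l2_norm_le_Linf_L2_norm:
  assumes f: "\<forall>s\<in>{0..T}. f s \<in> L2 \<Omega>" and t: "0 < t" "t < T"
    and cont: "L2_continuous_at T \<Omega> f t"
  shows "ereal (l2_norm \<Omega> (f t)) \<le> Linf_L2_norm T \<Omega> f"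
proof (rule ccontr)
  assume "\<not> ?thesis"
  then have less: "Linf_L2_norm T \<Omega> f < ereal (l2_norm \<Omega> (f t))" by simp
  then obtain c where c: "Linf_L2_norm T \<Omega> f < ereal c" "c < l2_norm \<Omega> (f t)"
    using ereal_dense2 by (metis less_ereal.simps(1))
  define \<epsilon> where "\<epsilon> = l2_norm \<Omega> (f t) - c"
  have "\<epsilon> > 0" using c by (simp add: \<epsilon>_def)
  then have "\<forall>\<^sub>F s in at t within {0..T}. l2_norm \<Omega> (\<lambda>x. f s x - f t x) < \<epsilon>"
    using cont unfolding L2_continuous_at_def by (rule order_tendstoD(2)[rotated])
  then obtain d where d: "d > 0" "\<And>s. s \<in> {0..T} \<Longrightarrow> s \<noteq> t \<Longrightarrow> dist s t < d \<Longrightarrow>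
      l2_norm \<Omega> (\<lambda>x. f s x - f t x) < \<epsilon>"
    by (auto simp: eventually_at)
  \<comment> \<open>A one-sided interval, cut off at T, already has positive length.\<close>
  define r where "r = min (t + d) T"
  have r: "t < r" "r \<le> T" "r \<le> t + d" using t d by (auto simp: r_def)
  have large: "c < l2_norm \<Omega> (f s)" if "s \<in> {t<..<r}" for s
  proof -
    have s: "s \<in> {0..T}" "s \<noteq> t" "dist s t < d" "t \<in> {0..T}"
      using that r t by (auto simp: dist_real_def)
    have "l2_norm \<Omega> (f t) \<le> l2_norm \<Omega> (f s) + l2_norm \<Omega> (\<lambda>x. f t x - f s x)"
      using f s by (intro l2_norm_le_add_diff) auto
    also have "l2_norm \<Omega> (\<lambda>x. f t x - f s x) = l2_norm \<Omega> (\<lambda>x. f s x - f t x)"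
      by (simp add: l2_norm_def l2_inner_def algebra_simps)
    finally show ?thesis using d(2)[OF s(1-3)] by (simp add: \<epsilon>_def)
  qed
  have "AE s in lebesgue_on {0<..<T}. ereal (l2_norm \<Omega> (f s)) \<le> Linf_L2_norm T \<Omega> f"
    unfolding Linf_L2_norm_def by (rule esssup_AE)
  then have "AE s in lebesgue. s \<in> {0<..<T} \<longrightarrow> ereal (l2_norm \<Omega> (f s)) \<le> Linf_L2_norm T \<Omega> f"
    by (subst (asm) AE_restrict_space_iff) auto
  then have "AE s in lebesgue. s \<notin> {t<..<r}"
  proof (rule AE_mp, intro AE_I2 impI notI)
    fix s assume le: "s \<in> {0<..<T} \<longrightarrow> ereal (l2_norm \<Omega> (f s)) \<le> Linf_L2_norm T \<Omega> f"
      and s: "s \<in> {t<..<r}"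
    have "ereal (l2_norm \<Omega> (f s)) < ereal c"
      using le s r t by (intro order.strict_trans1[OF _ c(1)]) auto
    then show False using large[OF s] by simp
  qed
  then have "emeasure lebesgue {t<..<r} = 0"
    by (subst (asm) AE_iff_measurable[of "{t<..<r}"]) auto
  then show False using r by simp
qed

section \<open>The discrete space\<close>

lemma fin_dim_subspace_closed:
  assumes "fin_dim_subspace V" "v \<in> V" "w \<in> V"
  shows "linear_comb c v d w \<in> V"
proof -
  obtain B where V: "V = {(\<lambda>x. \<Sum>b\<in>B. c b * b x) | c. True}"
    using assms(1) by (auto simp: fin_dim_subspace_def)
  obtain p q where "v = (\<lambda>x. \<Sum>b\<in>B. p b * b x)" "w = (\<lambda>x. \<Sum>b\<in>B. q b * b x)"
    using assms(2,3) unfolding V by auto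
  then have "linear_comb c v d w = (\<lambda>x. \<Sum>b\<in>B. (c * p b + d * q b) * b x)"
    by (auto simp: linear_comb_def sum_distrib_left sum.distrib[symmetric] algebra_simps)
  then show ?thesis unfolding V
    by (intro CollectI exI[of _ "\<lambda>b. c * p b + d * q b"]) simp
qed

text \<open>Makes the limit in \<open>tr\<close> unique. A triangle is convex with nonempty
  interior, hence the closure of its interior, and points in the closure of an open planar set are
  limit points of it.\<close>

lemma at_within_interior_triangle_nontrivial:
  fixes K :: "(real^2) set"
  assumes K: "2 simplex K" and z: "z \<in> K"
  shows "at z within interior K \<noteq> bot"
proof -
  have conv: "convex K" and cl: "closed K"
    using K by (auto simp: convex_simplex closed_simplex)
  have "aff_dim K = 2" using aff_dim_simplex[OF K] by simp
  then have "affine hull K = UNIV" by (intro iffD1[OF aff_dim_eq_full]) simp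
  then have "interior K \<noteq> {}"
    using conv z by (metis empty_iff rel_interior_eq_empty rel_interior_interior)
  then have "z \<in> closure (interior K)"
    using convex_closure_interior[OF conv] cl z by simp
  then have "z islimpt interior K"
    by (metis Un_iff closure_def interior_limit_point interior_interior mem_Collect_eq)
  then show ?thesis by (simp add: trivial_limit_within)
qed

lemma tr_zero:
  assumes "2 simplex K" "z \<in> K"
  shows "tr K (\<lambda>x. 0 :: 'b::{t2_space,zero}) z = 0"
  unfolding tr_def
  using at_within_interior_triangle_nontrivial[OF assms] by (intro tendsto_Lim) auto

text \<open>Traces of gradients in \<open>morley\<close> are taken at edge midpoints. An edge is a
  one-dimensional polytope, hence a segment whose extreme points are its two ends.\<close>

lemma edge_midpoint_in_triangle:
  assumes K: "2 simplex K" and e: "e edge_of K"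
  shows "edge_midpoint e \<in> K"
proof -
  have face: "e face_of K" and dim: "aff_dim e = 1"
    using e by (auto simp: edge_of_def)
  have "polytope e"
    using face_of_polytope_polytope[OF simplex_imp_polytope[OF K] face] .
  then obtain n where "n simplex e"
    using polytope_lowdim_imp_simplex[of e] dim by auto
  then have "1 simplex e"
    using aff_dim_simplex dim by metis
  then obtain a c where "\<not> affine_dependent {a, c}" "a \<noteq> c" and eq: "e = convex hull {a, c}"
    by (auto simp: simplex card_2_iff)
  then have "endpoints e = {a, c}"
    by (auto simp: endpoints_def extreme_point_of_convex_hull_affine_independent)
  then have "edge_midpoint e = midpoint a c"
    using \<open>a \<noteq> c\<close> by (simp add: edge_midpoint_def midpoint_def)
  also have "\<dots> \<in> e"
    unfolding eq segment_convex_hull[symmetric] by simp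
  finally show ?thesis using face by (auto dest: face_of_imp_subset)
qed

text \<open>Gives v = v + 0, which embeds \<open>V\<close> into the sum space on which
  \<open>a\<^sub>h\<close> is bilinear.\<close>

lemma zero_in_morley:
  assumes "\<And>K. K \<in> \<T> \<Longrightarrow> 2 simplex K"
  shows "(\<lambda>x. 0) \<in> morley \<Omega> \<T>"
proof -
  have grad0: "grad (\<lambda>x. 0) = (\<lambda>x. 0)"
    by (auto simp: grad_def pd_def frechet_derivative_const vec_eq_iff)
  have "polynomial2 2 (\<lambda>x. 0)"
    unfolding polynomial2_def by (rule exI[of _ "\<lambda>i j. 0"]) simp
  then have "(\<lambda>x. 0) \<in> broken_poly 2 \<T>"
    by (auto simp: broken_poly_def zero_on_skeleton_def)
  moreover have "tr K (\<lambda>x. 0 :: real) z = 0" if "K \<in> patch \<T> z" for K z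
    using that assms by (auto simp: patch_def intro: tr_zero)
  moreover have "tr K (grad (\<lambda>x. 0)) (edge_midpoint e) = 0" if "K \<in> adj \<T> e" for K e
    unfolding grad0 using that assms by (auto simp: adj_def intro!: tr_zero edge_midpoint_in_triangle)
  ultimately show ?thesis by (simp add: morley_def)
qed

lemma h_norm_nonneg: "0 \<le> h_norm \<T> v"
  unfolding h_norm_def by (intro real_sqrt_ge_zero add_nonneg_nonneg sum_nonneg) auto

lemma psd_form_discrete:
  assumes "\<And>K. K \<in> \<T> \<Longrightarrow> 2 simplex K" and "fin_dim_subspace V"
    and bil: "symmetric_bilinear_on (space_sum V (morley \<Omega> \<T>)) a\<^sub>h"
    and "0 \<le> \<alpha>" and coercive: "\<forall>w\<in>V. \<alpha> * (h_norm \<T> w)\<^sup>2 \<le> a\<^sub>h w w"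
  shows "psd_form V a\<^sub>h"
proof
  have "v \<in> space_sum V (morley \<Omega> \<T>)" if "v \<in> V" for v
    unfolding space_sum_def using that zero_in_morley[OF assms(1)]
    by (intro CollectI exI[of _ v] exI[of _ "\<lambda>x. 0"]) auto
  then show "symmetric_bilinear_on V a\<^sub>h"
    using bil by (simp add: symmetric_bilinear_on_def subset_iff)
  show "0 \<le> a\<^sub>h v v" if "v \<in> V" for v
    using coercive that \<open>0 \<le> \<alpha>\<close> by (meson mult_nonneg_nonneg order_trans zero_le_power2)
qed (intro fin_dim_subspace_closed assms(2))

text \<open>Here n stands for \<open>h_norm\<close>, p for the L2 norm and q for
  \<open>a\<^sub>h v v\<close>. Multiplying the CFL condition by the inverse inequality gives k
  sqrt(\<beta>) n \<le> p, which is then squared.\<close>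

lemma CFL_energy:
  assumes "0 < \<beta>" "0 < C" "0 < k" and CFL: "k \<le> \<beta> powr (- 1 / 2) * inverse C * h\<^sup>2"
    and n: "0 \<le> n" "n \<le> C * p / h\<^sup>2" and q: "q \<le> \<beta> * n * n"
  shows "k\<^sup>2 * q \<le> (p :: real)\<^sup>2"
proof -
  \<comment> \<open>With h = 0 the CFL bound would be zero, against k > 0; so the division by h^2 is
    genuine.\<close>
  have "h\<^sup>2 \<noteq> 0" using CFL \<open>0 < k\<close> by auto
  then have h: "0 < h\<^sup>2" by (metis zero_less_power2 power_zero_numeral)
  have eq: "\<beta> powr (- 1 / 2) = 1 / sqrt \<beta>"
    using \<open>0 < \<beta>\<close> by (simp add: powr_minus_divide powr_half_sqrt[symmetric])
  have "k * sqrt \<beta> * C \<le> h\<^sup>2"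
    using CFL assms(1,2) unfolding eq by (simp add: field_simps)
  moreover have "h\<^sup>2 * n \<le> C * p" using n h by (simp add: field_simps)
  ultimately have "k * sqrt \<beta> * C * n \<le> C * p"
    using n by (meson mult_right_mono order_trans)
  then have "k * sqrt \<beta> * n \<le> p" using \<open>0 < C\<close> by (simp add: algebra_simps)
  then have "(k * sqrt \<beta> * n)\<^sup>2 \<le> p\<^sup>2"
    using assms by (intro power_mono) auto
  moreover have "k\<^sup>2 * q \<le> (k * sqrt \<beta> * n)\<^sup>2"
    using mult_left_mono[OF q, of "k\<^sup>2"] \<open>0 < \<beta>\<close>
    by (simp add: power_mult_distrib power2_eq_square algebra_simps)
  ultimately show ?thesis by simp
qed

section \<open>Stability and the bound by the essential supremum of the source\<close>

theorem theorem3p6: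
  fixes \<alpha> \<beta> T :: real
  assumes "\<alpha> > 0" and "\<beta> > 0" and "T > 0"
  shows "\<exists>C>0. \<forall>\<Omega> \<T> \<kappa> V a\<^sub>h C\<^sub>i\<^sub>n\<^sub>v I\<^sub>M J R\<^sub>h f u\<^sub>0 v\<^sub>0 (N::nat) U k.
    polygonal_lipschitz_domain \<Omega> \<and>
    triangulation_of \<T> (closure \<Omega>) \<and> quasi_uniform \<kappa> \<T> \<and>
    fin_dim_subspace V \<and> V \<subseteq> broken_H2 \<T> \<and>
    symmetric_bilinear_on (space_sum V (morley \<Omega> \<T>)) a\<^sub>h \<and>
    (\<forall>w\<in>V. \<alpha> * (h_norm \<T> w)\<^sup>2 \<le> a\<^sub>h w w) \<and>
    (\<forall>w\<in>V. \<forall>v\<in>V. a\<^sub>h w v \<le> \<beta> * h_norm \<T> w * h_norm \<T> v) \<and>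
    C\<^sub>i\<^sub>n\<^sub>v > 0 \<and> (\<forall>v\<in>V. h_norm \<T> v \<le> C\<^sub>i\<^sub>n\<^sub>v * l2_norm \<Omega> v / (mesh_size \<T>)\<^sup>2) \<and>
    morley_interpolation \<Omega> \<T> I\<^sub>M \<and> companion_operator \<Omega> \<T> J \<and>
    modified_ritz \<Omega> V a\<^sub>h (\<lambda>v. J (I\<^sub>M v)) R\<^sub>h \<and>
    N > 0 \<and> k = T / real N \<and>
    f \<in> L2_L2 T \<Omega> \<and> (\<forall>n\<le>N. L2_continuous_at T \<Omega> f (real n * k)) \<and>
    u\<^sub>0 \<in> H20 \<Omega> \<and> v\<^sub>0 \<in> L2 \<Omega> \<and>
    (\<forall>n\<le>N. U n \<in> V) \<and> U 0 = R\<^sub>h u\<^sub>0 \<and>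
    first_step \<Omega> V a\<^sub>h k (\<lambda>n. f (real n * k)) v\<^sub>0 U \<and>
    explicit_steps \<Omega> V a\<^sub>h k N (\<lambda>n. f (real n * k)) U \<and>
    k \<le> \<beta> powr (- 1 / 2) * inverse C\<^sub>i\<^sub>n\<^sub>v * (mesh_size \<T>)\<^sup>2
    \<longrightarrow>
    stable_scheme C \<Omega> \<T> V a\<^sub>h k N \<and>
    (\<forall>m. 1 \<le> m \<and> m \<le> N - 1 \<longrightarrow>
       ereal (l2_norm \<Omega> (dt k U m) + h_norm \<T> (half U m))
         \<le> ereal C * (ereal (l2_norm \<Omega> (dt k U 0) + h_norm \<T> (half U 0)) + Linf_L2_norm T \<Omega> f))"
proof -
  \<comment> \<open>The constant of \<open>leapfrog_energy_bound\<close>, fixed before domain, mesh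
    and time step.\<close>
  define C where "C = (2 + 1 / sqrt \<alpha>) * (1 + sqrt \<beta> + 2 * T)"
  have C: "C > 0"
    unfolding C_def using assms by (intro mult_pos_pos add_pos_pos) auto
  show ?thesis
  proof (intro exI[of _ C] conjI[OF C] allI impI, elim conjE)
    fix \<Omega> \<T> \<kappa> V a\<^sub>h C\<^sub>i\<^sub>n\<^sub>v I\<^sub>M J R\<^sub>h f u\<^sub>0 v\<^sub>0 U k and N :: nat
    assume dom: "polygonal_lipschitz_domain \<Omega>"
      and tri: "triangulation_of \<T> (closure \<Omega>)"
      and V: "fin_dim_subspace V" "V \<subseteq> broken_H2 \<T>"
      and bil: "symmetric_bilinear_on (space_sum V (morley \<Omega> \<T>)) a\<^sub>h"
      and coercive: "\<forall>w\<in>V. \<alpha> * (h_norm \<T> w)\<^sup>2 \<le> a\<^sub>h w w"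
      and bounded: "\<forall>w\<in>V. \<forall>v\<in>V. a\<^sub>h w v \<le> \<beta> * h_norm \<T> w * h_norm \<T> v"
      and inv: "C\<^sub>i\<^sub>n\<^sub>v > 0" "\<forall>v\<in>V. h_norm \<T> v \<le> C\<^sub>i\<^sub>n\<^sub>v * l2_norm \<Omega> v / (mesh_size \<T>)\<^sup>2"
      and N: "N > 0" and k: "k = T / real N"
      and f: "f \<in> L2_L2 T \<Omega>" and cont: "\<forall>n\<le>N. L2_continuous_at T \<Omega> f (real n * k)"
      and U: "\<forall>n\<le>N. U n \<in> V"
      and steps: "explicit_steps \<Omega> V a\<^sub>h k N (\<lambda>n. f (real n * k)) U"
      and CFL: "k \<le> \<beta> powr (- 1 / 2) * inverse C\<^sub>i\<^sub>n\<^sub>v * (mesh_size \<T>)\<^sup>2"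
    have simplices: "2 simplex K" if "K \<in> \<T>" for K
      using tri that by (auto simp: triangulation_of_def)
    have "finite \<T>" using tri by (auto simp: triangulation_of_def triangulation_def)
    moreover have "\<Omega> \<in> sets lebesgue"
      using dom by (auto simp: polygonal_lipschitz_domain_def lipschitz_domain_def)
    ultimately have VL: "V \<subseteq> L2 \<Omega>" using V(2) broken_H2_subset_L2 by blast
    have k0: "k > 0" and kN: "real N * k = T" using k N assms by auto
    have a: "psd_form V a\<^sub>h"
      using psd_form_discrete[OF simplices V(1) bil _ coercive] assms(1) by simp
    interpret a: psd_form V a\<^sub>h by (rule a)
    interpret ip: psd_form "L2 \<Omega>" "l2_inner \<Omega>" by (rule psd_form_l2_inner)
    \<comment> \<open>Sequence, source and bound are left general: stability applies this to the
      difference of two solutions, the final bound to \<open>U\<close> itself.\<close>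
    have estimate: "energy_norm \<Omega> \<T> k W m \<le> C * (energy_norm \<Omega> \<T> k W 0 + M)"
      if W: "\<And>n. n \<le> N \<Longrightarrow> W n \<in> V" and st: "explicit_steps \<Omega> V a\<^sub>h k N F W"
        and F: "\<And>n. n \<in> {1..<N} \<Longrightarrow> F n \<in> L2 \<Omega> \<and> l2_norm \<Omega> (F n) \<le> M"
        and m: "m \<in> {1..<N}" for W F M m
      unfolding energy_norm_def C_def l2_norm_def
    proof (rule leapfrog_energy_bound[OF psd_form_l2_inner a VL assms(1,2) k0])
      show "real N * k \<le> T" using kN by simp
      show "0 \<le> h_norm \<T> v" for v by (rule h_norm_nonneg)
      show "\<alpha> * (h_norm \<T> v)\<^sup>2 \<le> a\<^sub>h v v" if "v \<in> V" for v using coercive that by auto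
      show "a\<^sub>h v v \<le> \<beta> * (h_norm \<T> v)\<^sup>2" if "v \<in> V" for v
        using bounded that by (auto simp: power2_eq_square mult.assoc)
      show "k\<^sup>2 * a\<^sub>h v v \<le> l2_inner \<Omega> v v" if "v \<in> V" for v
        unfolding l2_inner_eq_norm
        using CFL_energy[OF assms(2) inv(1) k0 CFL h_norm_nonneg] inv(2) bounded that by blast
      show "F n \<in> L2 \<Omega> \<and> sqrt (l2_inner \<Omega> (F n) (F n)) \<le> M" if "n \<in> {1..<N}" for n
        using F[OF that] by (simp add: l2_norm_def)
      show "l2_inner \<Omega> (d2t k W n) v + a\<^sub>h (W n) v = l2_inner \<Omega> (F n) v"
        if "n \<in> {1..<N}" "v \<in> V" for n v
        using st that by (auto simp: explicit_steps_def)
    qed (use W m in auto)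
    have stable: "stable_scheme C \<Omega> \<T> V a\<^sub>h k N"
      unfolding stable_scheme_def
    proof (intro allI impI ballI, elim conjE)
      fix U W F G m
      assume UW: "\<forall>n\<le>N. U n \<in> V \<and> W n \<in> V \<and> F n \<in> L2 \<Omega> \<and> G n \<in> L2 \<Omega>"
        and sU: "explicit_steps \<Omega> V a\<^sub>h k N F U" and sW: "explicit_steps \<Omega> V a\<^sub>h k N G W"
        and m: "m \<in> {1..<N}"
      show "energy_norm \<Omega> \<T> k (\<lambda>n x. U n x - W n x) m
        \<le> C * (energy_norm \<Omega> \<T> k (\<lambda>n x. U n x - W n x) 0
               + (MAX n\<in>{1..<N}. l2_norm \<Omega> (\<lambda>x. F n x - G n x)))"
      proof (rule estimate[OF _ _ _ m])
        show "(\<lambda>x. U n x - W n x) \<in> V" if "n \<le> N" for n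
          unfolding diff_eq_linear_comb using UW that by (intro a.closed) auto
        show "(\<lambda>x. F n x - G n x) \<in> L2 \<Omega> \<and>
            l2_norm \<Omega> (\<lambda>x. F n x - G n x) \<le> (MAX n\<in>{1..<N}. l2_norm \<Omega> (\<lambda>x. F n x - G n x))"
          if n: "n \<in> {1..<N}" for n
        proof
          show "(\<lambda>x. F n x - G n x) \<in> L2 \<Omega>"
            unfolding diff_eq_linear_comb using UW n by (intro ip.closed) auto
        qed (use n in \<open>auto intro!: Max_ge\<close>)
        show "explicit_steps \<Omega> V a\<^sub>h k N (\<lambda>n x. F n x - G n x) (\<lambda>n x. U n x - W n x)"
          unfolding explicit_steps_def
        proof (intro ballI)
          fix n v assume n: "n \<in> {1..<N}" and v: "v \<in> V"
          \<comment> \<open>Since n \<ge> 1, the second difference is a combination of two first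
            differences in \<open>V\<close>.\<close>
          have d2: "d2t k Z n \<in> L2 \<Omega>" if "\<forall>j\<le>N. Z j \<in> V" for Z
          proof -
            obtain j where j: "n = Suc j" "Suc j < N" using n by (cases n) auto
            have "dt k Z j \<in> V" "dt k Z (Suc j) \<in> V"
              unfolding dt_eq_linear_comb using that j by (auto intro!: a.closed)
            then have "d2t k Z n \<in> V"
              unfolding j using k0 by (simp add: d2t_eq_linear_comb a.closed)
            then show ?thesis using VL by auto
          qed
          have eq: "d2t k (\<lambda>n x. U n x - W n x) n = linear_comb 1 (d2t k U n) (-1) (d2t k W n)"
            by (auto simp: d2t_def linear_comb_def diff_divide_distrib add_divide_distrib algebra_simps)
          have vL: "v \<in> L2 \<Omega>" using v VL by auto
          have "n \<le> N" using n by simp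
          have "l2_inner \<Omega> (d2t k U n) v + a\<^sub>h (U n) v = l2_inner \<Omega> (F n) v"
            "l2_inner \<Omega> (d2t k W n) v + a\<^sub>h (W n) v = l2_inner \<Omega> (G n) v"
            using sU sW n v by (auto simp: explicit_steps_def)
          then show "l2_inner \<Omega> (d2t k (\<lambda>n x. U n x - W n x) n) v + a\<^sub>h (\<lambda>x. U n x - W n x) v
            = l2_inner \<Omega> (\<lambda>x. F n x - G n x) v"
            unfolding eq unfolding diff_eq_linear_comb
            using d2[of U] d2[of W] UW v vL \<open>n \<le> N\<close> by (simp add: ip.comb_left a.comb_left)
        qed
      qed
    qed
    have f_L2: "\<forall>t\<in>{0..T}. f t \<in> L2 \<Omega>" using f by (auto simp: L2_L2_def)
    have bound: "ereal (l2_norm \<Omega> (dt k U m) + h_norm \<T> (half U m))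
         \<le> ereal C * (ereal (l2_norm \<Omega> (dt k U 0) + h_norm \<T> (half U 0)) + Linf_L2_norm T \<Omega> f)"
      if m: "1 \<le> m \<and> m \<le> N - 1" for m
    proof -
      \<comment> \<open>Only interior grid times enter the scheme after the first step; there the
        essential supremum bounds point values.\<close>
      have grid: "0 < real n * k" "real n * k < T" if "n \<in> {1..<N}" for n
        using that k0 unfolding kN[symmetric] by auto
      have le: "ereal (l2_norm \<Omega> (f (real n * k))) \<le> Linf_L2_norm T \<Omega> f" if "n \<in> {1..<N}" for n
        using cont that grid[OF that] by (intro l2_norm_le_Linf_L2_norm[OF f_L2]) auto
      have mN: "m \<in> {1..<N}" using m N by auto
      show ?thesis
      \<comment> \<open>An infinite supremum makes the right-hand side infinite as C > 0, and minus
        infinity contradicts \<open>le\<close>.\<close>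
      proof (cases "Linf_L2_norm T \<Omega> f")
        case (real M)
        have "energy_norm \<Omega> \<T> k U m \<le> C * (energy_norm \<Omega> \<T> k U 0 + M)"
        proof (rule estimate[OF _ steps _ mN])
          show "f (real n * k) \<in> L2 \<Omega> \<and> l2_norm \<Omega> (f (real n * k)) \<le> M"
            if "n \<in> {1..<N}" for n
            using f_L2 grid[OF that] le[OF that] real by auto
        qed (use U in auto)
        then show ?thesis using real by (simp add: energy_norm_def)
      next
        case PInf
        then show ?thesis using C by simp
      next
        case MInf
        then show ?thesis using le[OF mN] by simp
      qed
    qed
    show "stable_scheme C \<Omega> \<T> V a\<^sub>h k N \<and>
      (\<forall>m. 1 \<le> m \<and> m \<le> N - 1 \<longrightarrow>
       ereal (l2_norm \<Omega> (dt k U m) + h_norm \<T> (half U m))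
         \<le> ereal C * (ereal (l2_norm \<Omega> (dt k U 0) + h_norm \<T> (half U 0)) + Linf_L2_norm T \<Omega> f))"
      using stable bound by blast
  qed
qed

end
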